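(* Let $k$ be an infinite field with $\operatorname{char}k\ne2$. A metrized $k$-algebra $(A,\circ,h)$ with antisymmetric multiplication is a cross product algebra if and only if it has constant sectional nonassociativity $1$.
   Context: Throughout the paper the base field has characteristic not dividing $6$ (that is, not $2$ or $3$). An algebra is a finite-dimensional $k$-vector space $A$ with a bilinear multiplication $\circ$. It is metrized if equipped with a nondegenerate symmetric bilinear form $h$ (a metric) that is invariant: $h(x\circ y,z)=h(x,y\circ z)$ for all $x,y,z\in A$. A metrized algebra $(A,\circ,h)$ is a (twofold) cross product algebra if $\circ$ is antisymmetric and $h(x\circ y,x\circ y)=h(x,x)h(y,y)-h(x,y)^2$ for all $x,y\in A$. For a metrized algebra of dimension at least $2$, the sectional nonassociativity of an $h$-nondegenerate two-dimensional subspace $\mathrm{Span}\{x,y\}$ is $$\mathcal{K}(x,y)=\frac{h(x\circ x,y\circ y)-h(x\circ y,y\circ x)}{h(x,x)h(y,y)-h(x,y)^2}.$$ It is constant equal to $c$ if $\mathcal{K}(x,y)=c$ for all $x,y$ spanning an $h$-nondegenerate two-dimensional subspace. *)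

theory Defs
  imports Complex_Main
begin

locale bilinear_algebra = vector_space scale
  for scale :: "'k::field \<Rightarrow> 'a::ab_group_add \<Rightarrow> 'a" (infixr \<open>*s\<close> 75) +
  fixes mult :: "'a \<Rightarrow> 'a \<Rightarrow> 'a" (infixl \<open>\<odot>\<close> 70)
  assumes finite_dimensional: "\<exists>B. finite B \<and> span B = UNIV"
    and mult_linear_right: "Vector_Spaces.linear scale scale (\<lambda>y. x \<odot> y)"
    and mult_linear_left: "Vector_Spaces.linear scale scale (\<lambda>x. x \<odot> y)"

definition nondegenerate_on :: "('a::zero \<Rightarrow> 'a \<Rightarrow> 'k::zero) \<Rightarrow> 'a set \<Rightarrow> bool" where
  "nondegenerate_on h W \<longleftrightarrow> (\<forall>x\<in>W. (\<forall>y\<in>W. h x y = 0) \<longrightarrow> x = 0)"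

definition antisymmetric_mult :: "('a \<Rightarrow> 'a \<Rightarrow> 'a::ab_group_add) \<Rightarrow> bool" where
  "antisymmetric_mult m \<longleftrightarrow> (\<forall>x y. m x y = - m y x)"

text \<open>Linearity of the metric in its second argument follows from symmetry.\<close>

locale metrized_algebra = bilinear_algebra scale mult
  for scale :: "'k::field \<Rightarrow> 'a::ab_group_add \<Rightarrow> 'a" (infixr \<open>*s\<close> 75)
    and mult :: "'a \<Rightarrow> 'a \<Rightarrow> 'a" (infixl \<open>\<odot>\<close> 70) +
  fixes h :: "'a \<Rightarrow> 'a \<Rightarrow> 'k"
  assumes metric_linear: "Vector_Spaces.linear scale (*) (\<lambda>x. h x y)"
    and metric_symmetric: "h x y = h y x"
    and metric_nondegenerate: "nondegenerate_on h UNIV"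
    and metric_invariant: "h (x \<odot> y) z = h x (y \<odot> z)"
begin

text \<open>Meaningful only when \<open>x\<close> and \<open>y\<close> span an \<open>h\<close>-nondegenerate plane; otherwise the
  denominator is zero and so is the quotient.\<close>

definition sectional_nonassociativity :: "'a \<Rightarrow> 'a \<Rightarrow> 'k" where
  "sectional_nonassociativity x y =
     (h (x \<odot> x) (y \<odot> y) - h (x \<odot> y) (y \<odot> x)) / (h x x * h y y - (h x y)\<^sup>2)"

text \<open>Below dimension 2 there are no planes and the condition holds vacuously.\<close>

definition constant_sectional_nonassociativity :: "'k \<Rightarrow> bool" where
  "constant_sectional_nonassociativity c \<longleftrightarrow>
     (\<forall>x y. dim (span {x, y}) = 2 \<and> nondegenerate_on h (span {x, y}) \<longrightarrow>
        sectional_nonassociativity x y = c)"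

end

locale cross_product_algebra = metrized_algebra scale mult h
  for scale :: "'k::field \<Rightarrow> 'a::ab_group_add \<Rightarrow> 'a" (infixr \<open>*s\<close> 75)
    and mult :: "'a \<Rightarrow> 'a \<Rightarrow> 'a" (infixl \<open>\<odot>\<close> 70)
    and h :: "'a \<Rightarrow> 'a \<Rightarrow> 'k" +
  assumes mult_antisymmetric: "antisymmetric_mult mult"
    and cross_product_norm: "h (x \<odot> y) (x \<odot> y) = h x x * h y y - (h x y)\<^sup>2"

end

theory Submission
  imports Defs "HOL-Computational_Algebra.Polynomial"
begin

text \<open>
  For an antisymmetric multiplication in characteristic other than 2 all squares vanish, so the
  numerator of the sectional nonassociativity of \<open>x\<close> and \<open>y\<close> is \<open>h (x \<odot> y) (x \<odot> y)\<close>, while its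
  denominator is the Gram determinant of the pair. The Gram determinant is nonzero exactly when
  the pair spans an \<open>h\<close>-nondegenerate plane (\<open>gram_nonzero_iff\<close>). Hence constant
  sectional nonassociativity 1 is the cross product identity restricted to pairs with nonzero
  Gram determinant (\<open>constant_sectional_nonassociativity_one_iff\<close>), and only the extension of that
  identity to the remaining pairs needs an argument.

  Those pairs are reached by Zariski density, made concrete along a line. Suppose some pair
  \<open>(u, v)\<close> has nonzero Gram determinant, and join \<open>(x, y)\<close> to \<open>(u, v)\<close> by the line through them.
  Along it both the Gram determinant and the defect of the cross product identity are polynomials
  in the parameter. Their product vanishes at every parameter, hence is the zero polynomial
  because the field is infinite; the first factor is not the zero polynomial, as it does not
  vanish at \<open>(u, v)\<close>. So the defect is the zero polynomial and vanishes at \<open>(x, y)\<close>.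

  If there is no such pair \<open>(u, v)\<close>, the Gram determinant is identically zero. Polarization and
  nondegeneracy of \<open>h\<close> then force the algebra to have dimension at most 1, the multiplication is
  zero, and the identity holds trivially (\<open>mult_zero_if_gram_zero\<close>).
\<close>

section \<open>Bilinearity and characteristic\<close>

lemma two_nonzero_if_char_not_2:
  assumes "CHAR('k::field) \<noteq> 2"
  shows "(2 :: 'k) \<noteq> 0"
proof
  assume "(2 :: 'k) = 0"
  then have "of_nat 2 = (0 :: 'k)" by simp
  then have "CHAR('k) dvd 2" by (simp only: of_nat_eq_0_iff_char_dvd)
  then have "CHAR('k) \<le> 2" "CHAR('k) > 0" using dvd_imp_le dvd_pos_nat[of 2] by auto
  moreover have "CHAR('k) \<noteq> 1" by simp
  ultimately show False using assms by linarith
qed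

context metrized_algebra
begin

lemma h_bilinear:
  "h (x + y) z = h x z + h y z" "h z (x + y) = h z x + h z y"
  "h (c *s x) z = c * h x z" "h z (c *s x) = c * h z x"
  "h (x - y) z = h x z - h y z" "h z (x - y) = h z x - h z y"
  "h (- x) z = - h x z" "h z (- x) = - h z x"
  "h 0 z = 0" "h z 0 = 0"
proof -
  interpret L: Vector_Spaces.linear scale "(*)" "\<lambda>x. h x z" for z by (rule metric_linear)
  show l: "h (x + y) z = h x z + h y z" "h (c *s x) z = c * h x z"
    "h (x - y) z = h x z - h y z" "h (- x) z = - h x z" "h 0 z = 0"
    for x y z c
    by (fact L.add L.scale L.diff L.neg L.zero)+
  show "h z (x + y) = h z x + h z y" "h z (c *s x) = c * h z x"
    "h z (x - y) = h z x - h z y" "h z (- x) = - h z x" "h z 0 = 0"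
    by (simp_all only: metric_symmetric[of z] l)
qed

lemma mult_bilinear:
  "(x + y) \<odot> z = x \<odot> z + y \<odot> z" "z \<odot> (x + y) = z \<odot> x + z \<odot> y"
  "(c *s x) \<odot> z = c *s (x \<odot> z)" "z \<odot> (c *s x) = c *s (z \<odot> x)"
proof -
  interpret L: Vector_Spaces.linear scale scale "\<lambda>x. x \<odot> z" for z by (rule mult_linear_left)
  interpret R: Vector_Spaces.linear scale scale "\<lambda>x. z \<odot> x" for z by (rule mult_linear_right)
  show "(x + y) \<odot> z = x \<odot> z + y \<odot> z" "z \<odot> (x + y) = z \<odot> x + z \<odot> y"
    "(c *s x) \<odot> z = c *s (x \<odot> z)" "z \<odot> (c *s x) = c *s (z \<odot> x)"
    by (fact L.add R.add L.scale R.scale)+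
qed

lemma eq_zero_if_orthogonal_to_all: "(\<And>y. h x y = 0) \<Longrightarrow> x = 0"
  using metric_nondegenerate by (auto simp: nondegenerate_on_def)

lemma square_zero:
  assumes "antisymmetric_mult mult" and "(2 :: 'k) \<noteq> 0"
  shows "x \<odot> x = 0"
proof -
  have "x \<odot> x = - (x \<odot> x)" using assms(1) unfolding antisymmetric_mult_def by blast
  then have "x \<odot> x + x \<odot> x = 0" by (metis add.right_inverse)
  then have "2 *s (x \<odot> x) = 0" using scale_left_distrib[of 1 1 "x \<odot> x"] by simp
  then show ?thesis using assms(2) by simp
qed


section \<open>Gram determinants and nondegenerate planes\<close>

definition gram :: "'a \<Rightarrow> 'a \<Rightarrow> 'k" where
  "gram x y = h x x * h y y - (h x y)\<^sup>2"

lemma dim_span_pair_eq_2_iff: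
  "dim (span {x, y}) = 2 \<longleftrightarrow> (\<forall>a b. a *s x + b *s y = 0 \<longrightarrow> a = 0 \<and> b = 0)"
proof
  have small: "dim (span {x, y}) \<noteq> 2" if "span {x, y} = span {z}" for z
    using dim_le_card'[of "{z}"] that by auto
  assume dim2: "dim (span {x, y}) = 2"
  show "\<forall>a b. a *s x + b *s y = 0 \<longrightarrow> a = 0 \<and> b = 0"
  proof (intro allI impI)
    fix a b assume ab: "a *s x + b *s y = 0"
    have "a = 0"
    proof (rule ccontr)
      assume a: "a \<noteq> 0"
      have "a *s x = - (b *s y)" using ab by (simp add: eq_neg_iff_add_eq_0)
      then have "inverse a *s (a *s x) = inverse a *s (- (b *s y))" by simp
      then have "x = (- (inverse a * b)) *s y" using a by simp
      then have "x \<in> span {y}" unfolding span_singleton by (rule range_eqI)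
      then show False using small[of y] dim2 by (simp add: span_redundant)
    qed
    moreover have "b = 0"
    proof (rule ccontr)
      assume b: "b \<noteq> 0"
      have "b *s y = 0" using ab \<open>a = 0\<close> by simp
      then have "y \<in> span {x}" using b by (simp add: span_zero)
      then show False using small[of x] dim2
        by (simp add: span_redundant insert_commute[of x y])
    qed
    ultimately show "a = 0 \<and> b = 0" by simp
  qed
next
  assume indep: "\<forall>a b. a *s x + b *s y = 0 \<longrightarrow> a = 0 \<and> b = 0"
  have "x \<noteq> c *s y" for c
    using indep[rule_format, of 1 "- c"] by auto
  then have x: "x \<notin> span {y}" by (auto simp: span_singleton)
  then have "x \<noteq> y" by (auto simp: span_base)
  moreover have "y \<noteq> 0" using indep[rule_format, of 0 1] by auto
  ultimately have "independent {x, y}" "card {x, y} = 2"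
    using x by (auto simp: independent_insert)
  then show "dim (span {x, y}) = 2" by (metis dim_span_eq_card_independent)
qed

text \<open>
  The combinations \<open>h y y *s x - h x y *s y\<close> and \<open>h x x *s y - h x y *s x\<close> pair with \<open>x\<close> and \<open>y\<close>
  to zero or to the Gram determinant. If that determinant is nonzero, these pairings read off the
  coefficients of a vector of the span; if it is zero, both combinations lie in the radical of
  the plane.
\<close>

lemma gram_nonzero_iff:
  "gram x y \<noteq> 0 \<longleftrightarrow> dim (span {x, y}) = 2 \<and> nondegenerate_on h (span {x, y})"
proof
  assume g: "gram x y \<noteq> 0"
  have radical: "a = 0 \<and> b = 0"
    if "h (a *s x + b *s y) x = 0" "h (a *s x + b *s y) y = 0" for a b
  proof -
    have "a * gram x y = h y y * h (a *s x + b *s y) x - h x y * h (a *s x + b *s y) y"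
      "b * gram x y = h x x * h (a *s x + b *s y) y - h x y * h (a *s x + b *s y) x"
      by (simp_all add: gram_def h_bilinear metric_symmetric[of y x] algebra_simps
          power2_eq_square)
    then show ?thesis using that g by simp
  qed
  have "nondegenerate_on h (span {x, y})"
    unfolding nondegenerate_on_def
  proof (intro ballI impI)
    fix z assume z: "z \<in> span {x, y}" "\<forall>w\<in>span {x, y}. h z w = 0"
    then obtain a b where "z = a *s x + b *s y"
      by (auto simp: span_insert span_singleton diff_eq_eq add.commute)
    moreover have "h z x = 0" "h z y = 0" using z(2) by (auto simp: span_base)
    ultimately show "z = 0" using radical[of a b] by simp
  qed
  moreover have "dim (span {x, y}) = 2"
    unfolding dim_span_pair_eq_2_iff
  proof (intro allI impI)
    fix a b assume "a *s x + b *s y = 0"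
    then show "a = 0 \<and> b = 0" by (intro radical) (simp_all only: h_bilinear)
  qed
  ultimately show "dim (span {x, y}) = 2 \<and> nondegenerate_on h (span {x, y})" by simp
next
  assume plane: "dim (span {x, y}) = 2 \<and> nondegenerate_on h (span {x, y})"
  then have indep: "a = 0 \<and> b = 0" if "a *s x + b *s y = 0" for a b
    using that plane unfolding dim_span_pair_eq_2_iff by blast
  have orth: "a = 0 \<and> b = 0"
    if "h (a *s x + b *s y) x = 0" "h (a *s x + b *s y) y = 0" for a b
  proof -
    let ?z = "a *s x + b *s y"
    have "h ?z w = 0" if "w \<in> span {x, y}" for w
    proof -
      obtain c d where "w = c *s x + d *s y"
        using \<open>w \<in> span {x, y}\<close>
        by (auto simp: span_insert span_singleton diff_eq_eq add.commute)
      then have "h ?z w = c * h ?z x + d * h ?z y" by (simp only: h_bilinear)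
      then show ?thesis using \<open>h ?z x = 0\<close> \<open>h ?z y = 0\<close> by simp
    qed
    moreover have "?z \<in> span {x, y}"
      by (intro span_add span_scale span_base) auto
    ultimately have "?z = 0" using plane by (auto simp: nondegenerate_on_def)
    then show ?thesis by (rule indep)
  qed
  show "gram x y \<noteq> 0"
  proof
    assume g: "gram x y = 0"
    have "h y y = 0 \<and> - h x y = 0"
      by (rule orth) (use g in \<open>simp_all add: gram_def h_bilinear metric_symmetric[of y x]
          algebra_simps power2_eq_square\<close>)
    then have "h x x = 0" "h x y = 0"
      using orth[of "- h x y" "h x x"] g
      by (simp_all add: gram_def h_bilinear metric_symmetric[of y x] algebra_simps
          power2_eq_square)
    then have "h (1 *s x + 0 *s y) x = 0" "h (1 *s x + 0 *s y) y = 0" by simp_all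
    then show False using orth[of 1 0] by simp
  qed
qed

lemma constant_sectional_nonassociativity_one_iff:
  assumes "antisymmetric_mult mult" and "(2 :: 'k) \<noteq> 0"
  shows "constant_sectional_nonassociativity 1 \<longleftrightarrow>
    (\<forall>x y. gram x y \<noteq> 0 \<longrightarrow> h (x \<odot> y) (x \<odot> y) = gram x y)"
proof -
  have "sectional_nonassociativity x y = h (x \<odot> y) (x \<odot> y) / gram x y" for x y
  proof -
    have "y \<odot> x = - (x \<odot> y)" using assms(1) unfolding antisymmetric_mult_def by blast
    then show ?thesis
      by (simp add: sectional_nonassociativity_def gram_def square_zero[OF assms] h_bilinear)
  qed
  then show ?thesis
    unfolding constant_sectional_nonassociativity_def gram_nonzero_iff[symmetric] by auto
qed


section \<open>Algebras with identically vanishing Gram determinant\<close>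

text \<open>
  Such an algebra has dimension at most 1. If \<open>h u u \<noteq> 0\<close>, polarizing \<open>gram u v = 0\<close> in \<open>v\<close>
  shows that \<open>h u u *s v - h u v *s u\<close> is orthogonal to everything, so each \<open>v\<close> is a multiple
  of \<open>u\<close>. If \<open>h u u = 0\<close> for all \<open>u\<close>, polarizing gives \<open>h = 0\<close>, so the algebra is zero.
\<close>

lemma mult_zero_if_gram_zero:
  assumes "antisymmetric_mult mult" and two: "(2 :: 'k) \<noteq> 0"
    and gram0: "\<And>u v. gram u v = 0"
  shows "x \<odot> y = 0"
proof (cases "\<exists>u. h u u \<noteq> 0")
  case True
  then obtain u where u: "h u u \<noteq> 0" by blast
  have multiple: "\<exists>c. v = c *s u" for v
  proof -
    have "h (h u u *s v - h u v *s u) w = 0" for w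
    proof -
      have "2 * h (h u u *s v - h u v *s u) w = gram u (v + w) - gram u v - gram u w"
        by (simp add: gram_def h_bilinear metric_symmetric[of w v] algebra_simps
            power2_eq_square)
      then show ?thesis using two gram0 by simp
    qed
    then have "h u u *s v - h u v *s u = 0" by (rule eq_zero_if_orthogonal_to_all)
    then have "inverse (h u u) *s (h u u *s v) = inverse (h u u) *s (h u v *s u)" by simp
    then have "v = (inverse (h u u) * h u v) *s u" using u by simp
    then show ?thesis by blast
  qed
  obtain a b where "x = a *s u" "y = b *s u" using multiple by blast
  then show ?thesis by (simp add: mult_bilinear square_zero[OF assms(1,2)])
next
  case False
  have "h z w = 0" for z w
  proof -
    have "2 * h z w = h (z + w) (z + w) - h z z - h w w"
      by (simp add: h_bilinear metric_symmetric[of w z])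
    then show ?thesis using False two by simp
  qed
  then show ?thesis by (auto intro: eq_zero_if_orthogonal_to_all)
qed


section \<open>Extending the identity along lines\<close>

text \<open>Degree 2 suffices for the curves below: the product of two points, each moving along a
  line, traces a quadratic curve.\<close>

lemma metric_polynomial_along_quadratic_curves:
  "\<exists>p. \<forall>t. poly p t =
    h (a0 + t *s a1 + (t * t) *s a2) (b0 + t *s b1 + (t * t) *s b2)"
  by (rule exI[of _ "[: h a0 b0, h a0 b1 + h a1 b0, h a0 b2 + h a1 b1 + h a2 b0,
        h a1 b2 + h a2 b1, h a2 b2 :]"])
    (simp add: h_bilinear algebra_simps)

lemma metric_polynomial_along_lines: "\<exists>p. \<forall>t. poly p t = h (a + t *s c) (b + t *s d)"
  using metric_polynomial_along_quadratic_curves[of a c 0 b d 0] by simp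

lemma gram_polynomial_along_lines: "\<exists>p. \<forall>t. poly p t = gram (x + t *s w) (y + t *s z)"
proof -
  obtain p where p: "\<And>t. poly p t = h (x + t *s w) (x + t *s w)"
    using metric_polynomial_along_lines by metis
  obtain q where q: "\<And>t. poly q t = h (y + t *s z) (y + t *s z)"
    using metric_polynomial_along_lines by metis
  obtain r where r: "\<And>t. poly r t = h (x + t *s w) (y + t *s z)"
    using metric_polynomial_along_lines by metis
  have "poly (p * q - r\<^sup>2) t = gram (x + t *s w) (y + t *s z)" for t
    by (simp add: gram_def p q r)
  then show ?thesis by blast
qed

lemma product_norm_polynomial_along_lines:
  "\<exists>p. \<forall>t. poly p t =
    h ((x + t *s w) \<odot> (y + t *s z)) ((x + t *s w) \<odot> (y + t *s z))"
proof -
  have "(x + t *s w) \<odot> (y + t *s z) = x \<odot> y + t *s (x \<odot> z + w \<odot> y) + (t * t) *s (w \<odot> z)" for t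
    by (simp add: mult_bilinear scale_right_distrib algebra_simps)
  then show ?thesis by (simp only: metric_polynomial_along_quadratic_curves)
qed

lemma cross_product_identity_extends:
  assumes inf: "infinite (UNIV :: 'k set)"
    and generic: "\<And>x y. gram x y \<noteq> 0 \<Longrightarrow> h (x \<odot> y) (x \<odot> y) = gram x y"
    and uv: "gram u v \<noteq> 0"
  shows "h (x \<odot> y) (x \<odot> y) = gram x y"
proof -
  let ?X = "\<lambda>t. x + t *s (u - x)" and ?Y = "\<lambda>t. y + t *s (v - y)"
  obtain g where g: "\<And>t. poly g t = gram (?X t) (?Y t)"
    using gram_polynomial_along_lines by metis
  obtain n where n: "\<And>t. poly n t = h (?X t \<odot> ?Y t) (?X t \<odot> ?Y t)"
    using product_norm_polynomial_along_lines by metis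
  have "poly ((n - g) * g) t = 0" for t
    using generic[of "?X t" "?Y t"] by (auto simp: g n)
  then have "{t. poly ((n - g) * g) t = 0} = UNIV" by blast
  then have "(n - g) * g = 0" using inf poly_roots_finite by metis
  moreover have "poly g 1 = gram u v" by (simp add: g)
  then have "g \<noteq> 0" using uv by auto
  ultimately have "n = g" by simp
  then show ?thesis using n[of 0] g[of 0] by simp
qed

end

theorem theorem5p4:
  fixes scale :: "'k::field \<Rightarrow> 'a::ab_group_add \<Rightarrow> 'a"
    and mult :: "'a \<Rightarrow> 'a \<Rightarrow> 'a"
    and h :: "'a \<Rightarrow> 'a \<Rightarrow> 'k"
  assumes "infinite (UNIV :: 'k set)"
    and "CHAR('k) \<noteq> 2"
    and "metrized_algebra scale mult h"
    and "antisymmetric_mult mult"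
  shows "cross_product_algebra scale mult h \<longleftrightarrow>
    metrized_algebra.constant_sectional_nonassociativity scale mult h 1"
proof -
  interpret metrized_algebra scale mult h by fact
  have two: "(2 :: 'k) \<noteq> 0" using assms(2) by (rule two_nonzero_if_char_not_2)
  have "cross_product_algebra scale mult h \<longleftrightarrow>
      (\<forall>x y. h (mult x y) (mult x y) = gram x y)"
    using assms(3,4)
    by (auto simp: cross_product_algebra_def cross_product_algebra_axioms_def gram_def)
  also have "\<dots> \<longleftrightarrow> (\<forall>x y. gram x y \<noteq> 0 \<longrightarrow> h (mult x y) (mult x y) = gram x y)"
  proof (intro iffI allI)
    fix x y
    assume generic: "\<forall>x y. gram x y \<noteq> 0 \<longrightarrow> h (mult x y) (mult x y) = gram x y"
    show "h (mult x y) (mult x y) = gram x y"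
    proof (cases "\<exists>u v. gram u v \<noteq> 0")
      case True
      then show ?thesis using cross_product_identity_extends[OF assms(1)] generic by blast
    next
      case False
      then show ?thesis using mult_zero_if_gram_zero[OF assms(4) two] by (simp add: h_bilinear)
    qed
  qed simp
  also have "\<dots> \<longleftrightarrow> constant_sectional_nonassociativity 1"
    using constant_sectional_nonassociativity_one_iff[OF assms(4) two] by simp
  finally show ?thesis .
qed

end
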